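(* Let $X$ and $Y$ be non-negative random variables with distributions $F$ and $G$ respectively, where $F$ has support $[0,\infty)$, and let $H$ be the distribution of the product $XY$. Suppose that (A) for any $c>0$, $\overline{G}(cx)=o[\overline{H}(x)]$ as $x\to\infty$; (B) there exists a function $h:[0,\infty)\to(0,\infty)$ such that $\mathbf{P}[X>x\mid Y=y]\sim h(y)\,\mathbf{P}[X>x]$ as $x\to\infty$, uniformly for $y\in S_Y$; and that $0<\mathbf{E}[Y]<\infty$. Then: (1) if $F\in\mathcal{M}^*$, then $H\in\mathcal{M}^*$; (2) if $F\in\mathcal{M}$, then $H\in\mathcal{M}$.
   Context: For a distribution $F$ write $\overline{F}:=1-F$; throughout $\overline{F}(x)>0$ for all $x\ge 0$. $H(x):=\mathbf{P}[XY\le x]$. $S_Y$ is the support of $Y$. Uniformity in (B) means $\lim_{x\to\infty}\sup_{y\in S_Y}\left|\frac{\mathbf{P}[X>x\mid Y=y]}{h(y)\mathbf{P}[X>x]}-1\right|=0$. For a distribution $F$ of a random variable $X$ on $[0,\infty)$ with $0<\mathbf{E}[X]<\infty$, put $\overline{F}_I(x)=\frac{1}{\mathbf{E}[X]}\int_x^\infty \overline{F}(y)\,dy$. Then $F\in\mathcal{M}$ if $\lim_{x\to\infty}\frac{\overline{F}(x)}{\mathbf{E}[X]\,\overline{F}_I(x)}=0$, and $F\in\mathcal{M}^*$ if $\limsup_{x\to\infty}\frac{x\,\overline{F}(x)}{\mathbf{E}[X]\,\overline{F}_I(x)}<\infty$. *)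

theory Defs
  imports "HOL-Probability.Probability" "HOL-Library.Landau_Symbols"
begin

text \<open>Distributions are represented by probability measures on the Borel sets of the real line.\<close>

definition tail :: "real measure \<Rightarrow> real \<Rightarrow> real" where
  "tail F x = 1 - cdf F x"

definition mean :: "real measure \<Rightarrow> real" where
  "mean F = (\<integral>x. x \<partial>F)"

definition tail_I :: "real measure \<Rightarrow> real \<Rightarrow> real" where
  "tail_I F x = (1 / mean F) * (LBINT y:{x..}. tail F y)"

definition msupport :: "'a::topological_space measure \<Rightarrow> 'a set" where
  "msupport F = {x. \<forall>U. open U \<and> x \<in> U \<longrightarrow> emeasure F U > 0}"

text \<open>The distributions on \<open>[0,\<infinity>)\<close> with a positive tail and a positive, finite mean. Positivity of
  the tail is required explicitly since otherwise, by \<open>0 / 0 = 0\<close>, a distribution with bounded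
  support would belong to both classes below. Integrability has to be required separately since
  the integral of a non-integrable function is \<open>0\<close> by convention.\<close>

definition admissible :: "real measure \<Rightarrow> bool" where
  "admissible F \<longleftrightarrow> real_distribution F \<and> (AE x in F. 0 \<le> x) \<and> (\<forall>x\<ge>0. 0 < tail F x) \<and>
     integrable F (\<lambda>x. x) \<and> 0 < mean F"

definition class_M :: "real measure set" where
  "class_M = {F. admissible F \<and>
     ((\<lambda>x. tail F x / (mean F * tail_I F x)) \<longlongrightarrow> 0) at_top}"

definition class_M_star :: "real measure set" where
  "class_M_star = {F. admissible F \<and>
     Limsup at_top (\<lambda>x. ereal (x * tail F x / (mean F * tail_I F x))) < \<infinity>}"

text \<open>\<open>K y\<close> is a version of the conditional distribution of \<open>X\<close> given \<open>Y = y\<close>: a Markov kernel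
  that disintegrates the joint distribution of \<open>(X, Y)\<close> over the distribution of \<open>Y\<close>. In
  particular \<open>K y {x<..}\<close> is \<open>P[X > x | Y = y]\<close>.\<close>

definition cond_distr ::
    "'a measure \<Rightarrow> ('a \<Rightarrow> real) \<Rightarrow> ('a \<Rightarrow> real) \<Rightarrow> (real \<Rightarrow> real measure) \<Rightarrow> bool" where
  "cond_distr M X Y K \<longleftrightarrow> K \<in> borel \<rightarrow>\<^sub>M prob_algebra borel \<and>
     (\<forall>A\<in>sets borel. \<forall>B\<in>sets borel.
        emeasure M {\<omega> \<in> space M. X \<omega> \<in> A \<and> Y \<omega> \<in> B}
          = (\<integral>\<^sup>+y\<in>B. emeasure (K y) A \<partial>distr M borel Y))"

end

theory Submission
  imports Defs
begin

text \<open>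
  Both classes compare a tail with the mean excess \<open>E[(X - x)\<^sup>+]\<close>, which equals
  \<open>\<integral>\<^sub>x\<^sup>\<infinity> P[X > v] dv\<close>. The excess behaves well under products: conditionally on \<open>Y = y > 0\<close>,
  \<open>E[(Xy - x)\<^sup>+ | Y = y] = y E[(X - x/y)\<^sup>+ | Y = y]\<close>. Uniform equivalence (B) enters
  as a two-sided bound with the constants \<open>1/3\<close> and \<open>3\<close>: beyond some level \<open>v\<^sub>1\<close>, the
  conditional tail of \<open>X\<close> given \<open>Y = y\<close> is comparable with \<open>k(y)\<close> times the tail of \<open>F\<close>, where
  \<open>k(y) = P[X > v\<^sub>1 | Y = y] / P[X > v\<^sub>1]\<close> replaces \<open>h\<close> (it is measurable and bounded).

  Suppose that the tail of \<open>F\<close> satisfies \<open>r(v) P[X > v] \<le> E[(X - v)\<^sup>+]\<close> for \<open>v \<ge> v\<^sub>0\<close>.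
  Transferring this to the conditional distributions at \<open>v = x/y\<close>, with \<open>y \<le> x/v\<^sub>0\<close>, and
  integrating over \<open>y \<in> B\<close> gives, up to the factor 9, the bound
  \<open>inf\<^bsub>y \<in> B\<^esub> y r(x/y) \<cdot> P[XY > x, Y \<in> B] \<le> E[(XY - x)\<^sup>+]\<close>
  (lemma \<open>excess_H_lower_bound\<close>). By (A), the event \<open>Y > x/v\<^sub>0\<close> carries at most half of
  \<open>P[XY > x]\<close> (lemma \<open>tail_H_truncate\<close>), so it suffices to control \<open>Y \<le> x/v\<^sub>0\<close>.

  For the starred class \<open>r(v) = v / C\<close>. Then \<open>y r(x/y) = x / C\<close> does not depend on \<open>y\<close>, and
  \<open>B = (0, x/v\<^sub>0]\<close> gives the claim.

  For the other class \<open>r\<close> is a large constant, and the factor \<open>y\<close> is lost for small \<open>y\<close>. But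
  a small factor requires a larger \<open>X\<close>: for fixed \<open>\<delta>\<close> such that \<open>Y \<ge> \<delta>\<close> has positive
  probability, both \<open>P[XY > x, Y < \<delta>]\<close> and \<open>P[XY > x, \<delta> \<le> Y \<le> x/v\<^sub>0]\<close> compare with
  \<open>P[X > x/\<delta>]\<close>, from above and from below respectively, for large \<open>x\<close> and with constants that depend neither
  on \<open>x\<close> nor on \<open>r\<close> (lemma \<open>small_factor_dominated\<close>). Hence \<open>B = [\<delta>, x/v\<^sub>0]\<close> already
  carries a fixed proportion of \<open>P[XY > x]\<close>, on which the bound \<open>y r(x/y) \<ge> \<delta> r\<close> is
  as large as desired.
\<close>

section \<open>Tails, supports and the mean excess\<close>

text \<open>The mean excess is taken in the extended non-negative reals, where \<^const>\<open>ennreal\<close>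
  performs the positive part and Tonelli's theorem applies without integrability conditions.\<close>

definition excess :: "real measure \<Rightarrow> real \<Rightarrow> ennreal" where
  "excess F x = (\<integral>\<^sup>+ z. ennreal (z - x) \<partial>F)"

lemma tail_eq_measure:
  assumes "prob_space F" "sets F = sets borel"
  shows "tail F x = measure F {x<..}"
proof -
  interpret prob_space F by fact
  have sp: "space F = UNIV" using sets_eq_imp_space_eq[OF assms(2)] by simp
  have "UNIV - {..x} = {x<..}" by auto
  then show ?thesis
    using prob_compl[of "{..x}"] assms(2) sp by (simp add: tail_def cdf_def)
qed

text \<open>The complement of the support is a union of open null sets; since the topology
  has a countable basis, countably many of them suffice.\<close>

lemma AE_msupport:
  fixes P :: "real measure"
  assumes P: "sets P = sets borel"
  shows "AE x in P. x \<in> msupport P"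
proof -
  obtain \<B> :: "real set set" where "countable \<B>" "topological_basis \<B>"
    using ex_countable_basis by blast
  define \<N> where "\<N> = {U \<in> \<B>. emeasure P U = 0}"
  have "countable \<N>" using \<open>countable \<B>\<close> by (simp add: \<N>_def)
  have "U \<in> null_sets P" if "U \<in> \<N>" for U
    using that topological_basis_open[OF \<open>topological_basis \<B>\<close>] P
    by (auto simp: \<N>_def null_sets_def)
  then have "(\<Union>U\<in>\<N>. U) \<in> null_sets P"
    using \<open>countable \<N>\<close> by (intro null_sets_UN') auto
  moreover have "{x \<in> space P. x \<notin> msupport P} \<subseteq> (\<Union>U\<in>\<N>. U)"
  proof
    fix x assume "x \<in> {x \<in> space P. x \<notin> msupport P}"
    then obtain V where V: "open V" "x \<in> V" "emeasure P V = 0"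
      by (auto simp: msupport_def not_gr_zero)
    then obtain U where U: "U \<in> \<B>" "x \<in> U" "U \<subseteq> V"
      using topological_basisE[OF \<open>topological_basis \<B>\<close>] by metis
    have "emeasure P U \<le> emeasure P V" using V U P by (intro emeasure_mono) auto
    then show "x \<in> (\<Union>U\<in>\<N>. U)" using U V by (auto simp: \<N>_def)
  qed
  ultimately show ?thesis by (rule AE_I')
qed

text \<open>Both sides are the measure of the region \<open>x \<le> v < z\<close> under the product of the Lebesgue
  measure in \<open>v\<close> and \<open>P\<close> in \<open>z\<close>.\<close>

lemma nn_integral_tail:
  assumes "prob_space P" and P: "sets P = sets borel"
  shows "(\<integral>\<^sup>+ v\<in>{x..}. ennreal (measure P {v<..}) \<partial>lborel) = excess P x"
proof -
  interpret prob_space P by fact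
  interpret pair_sigma_finite P lborel ..
  note [measurable_cong] = P
  have "(\<integral>\<^sup>+ v\<in>{x..}. ennreal (measure P {v<..}) \<partial>lborel)
      = (\<integral>\<^sup>+ v. \<integral>\<^sup>+ z. indicator {x..} v * indicator {v<..} z \<partial>P \<partial>lborel)"
    using P by (intro nn_integral_cong)
      (simp add: nn_integral_cmult emeasure_eq_measure mult.commute)
  also have "\<dots> = (\<integral>\<^sup>+ v. \<integral>\<^sup>+ z. (if x \<le> v \<and> v < z then 1 else 0) \<partial>P \<partial>lborel)"
    by (intro nn_integral_cong) (auto simp: indicator_def)
  also have "\<dots> = (\<integral>\<^sup>+ z. \<integral>\<^sup>+ v. (if x \<le> v \<and> v < z then 1 else 0) \<partial>lborel \<partial>P)"
    by (rule Fubini') measurable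
  also have "\<dots> = (\<integral>\<^sup>+ z. emeasure lborel {x..<z} \<partial>P)"
    by (intro nn_integral_cong) (auto simp flip: nn_integral_indicator
        intro!: nn_integral_cong simp: indicator_def)
  also have "\<dots> = excess P x"
    unfolding excess_def
  proof (rule nn_integral_cong)
    show "emeasure lborel {x..<z} = ennreal (z - x)" for z
      by (cases "x \<le> z") (auto simp: ennreal_neg)
  qed
  finally show ?thesis .
qed

lemma borel_measurable_tail:
  fixes F :: "real measure"
  assumes "prob_space F" "sets F = sets borel"
  shows "(\<lambda>v. measure F {v<..}) \<in> borel_measurable borel"
proof -
  interpret prob_space F by fact
  have "mono (\<lambda>v::real. - measure F {v<..})"
  proof (rule monoI)
    fix v w :: real assume "v \<le> w"
    then have "measure F {w<..} \<le> measure F {v<..}"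
      using assms(2) by (intro finite_measure_mono) auto
    then show "- measure F {v<..} \<le> - measure F {w<..}" by simp
  qed
  from borel_measurable_uminus[OF borel_measurable_mono[OF this]] show ?thesis by simp
qed

lemma integral_tail:
  assumes "prob_space F" "sets F = sets borel"
  shows "(LBINT v:{x..}. tail F v) = enn2real (excess F x)"
proof -
  have "(LBINT v:{x..}. tail F v)
      = enn2real (\<integral>\<^sup>+ v. ennreal (indicator {x..} v *\<^sub>R tail F v) \<partial>lborel)"
    unfolding set_lebesgue_integral_def tail_eq_measure[OF assms]
    using borel_measurable_tail[OF assms] by (intro integral_eq_nn_integral) auto
  also have "(\<integral>\<^sup>+ v. ennreal (indicator {x..} v *\<^sub>R tail F v) \<partial>lborel) = excess F x"
    unfolding nn_integral_tail[OF assms, symmetric] tail_eq_measure[OF assms]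
    by (intro nn_integral_cong) (auto simp: indicator_def)
  finally show ?thesis .
qed

text \<open>The denominators in the definitions of both classes are the mean excess. Its positivity
  is what allows the quotients to be cleared.\<close>

lemma
  assumes "admissible F"
  shows mean_tail_I: "ennreal (mean F * tail_I F x) = excess F x"
    and mean_tail_I_pos: "0 \<le> x \<Longrightarrow> 0 < mean F * tail_I F x"
proof -
  interpret real_distribution F using assms by (simp add: admissible_def)
  have F: "prob_space F" "sets F = sets borel"
    by (rule prob_space_axioms, rule events_eq_borel)
  have "mean F \<noteq> 0" using assms by (simp add: admissible_def)
  then have eq: "mean F * tail_I F x = enn2real (excess F x)" for x
    by (simp add: tail_I_def integral_tail[OF F])
  have fin: "excess F x < \<infinity>" for x
  proof -
    have "integrable F (\<lambda>z. z - x)"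
      using assms by (intro Bochner_Integration.integrable_diff) (auto simp: admissible_def)
    moreover have "excess F x \<le> (\<integral>\<^sup>+ z. ennreal (norm (z - x)) \<partial>F)"
      unfolding excess_def by (intro nn_integral_mono ennreal_leI) auto
    ultimately show ?thesis unfolding integrable_iff_bounded by (metis le_less_trans)
  qed
  show "ennreal (mean F * tail_I F x) = excess F x"
    unfolding eq using fin[of x] by (simp add: less_top)
  show "0 < mean F * tail_I F x" if "0 \<le> x"
  proof -
    have "excess F x \<noteq> 0"
    proof
      assume "excess F x = 0"
      then have "AE z in F. z \<notin> {x<..}"
        unfolding excess_def by (subst (asm) nn_integral_0_iff_AE) (auto simp: ennreal_eq_0_iff)
      then have "measure F {x<..} = 0"
        by (subst prob_eq_0) auto
      moreover have "0 < tail F x" using assms that by (simp add: admissible_def)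
      ultimately show False using tail_eq_measure[OF F, of x] by simp
    qed
    then show ?thesis unfolding eq using fin[of x] by (simp add: enn2real_positive_iff zero_less_iff_neq_zero less_top)
  qed
qed

section \<open>Products under a conditional distribution\<close>

locale kernel_product = prob_space M for M :: "'a measure" +
  fixes X Y :: "'a \<Rightarrow> real" and K :: "real \<Rightarrow> real measure"
  assumes X [measurable]: "X \<in> borel_measurable M"
    and Y [measurable]: "Y \<in> borel_measurable M"
    and cond_distr: "cond_distr M X Y K"
begin

abbreviation "F \<equiv> distr M borel X"
abbreviation "G \<equiv> distr M borel Y"
abbreviation "H \<equiv> distr M borel (\<lambda>\<omega>. X \<omega> * Y \<omega>)"

lemma prob_spaces: "prob_space F" "prob_space G" "prob_space H"
  by (auto intro: prob_space_distr)

lemma kernel: "K \<in> borel \<rightarrow>\<^sub>M prob_algebra borel"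
  using cond_distr by (simp add: cond_distr_def)

lemma kernel_subprob [measurable]: "K \<in> borel \<rightarrow>\<^sub>M subprob_algebra borel"
  using kernel by (rule measurable_prob_algebraD)

lemma prob_space_kernel: "prob_space (K y)" and sets_kernel [measurable_cong]: "sets (K y) = sets borel"
  using measurable_space[OF kernel, of y] by (auto simp: space_prob_algebra)

lemma measurable_kernel_tail [measurable]:
  assumes [measurable]: "g \<in> borel_measurable borel"
  shows "(\<lambda>y. measure (K y) {g y<..}) \<in> borel_measurable borel"
proof (rule measure_measurable_subprob_algebra2)
  have "(SIGMA y:space borel. {g y<..}) = {p \<in> space (borel \<Otimes>\<^sub>M borel). g (fst p) < snd p}"
    by (auto simp: space_pair_measure)
  also have "\<dots> \<in> sets (borel \<Otimes>\<^sub>M borel)" by measurable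
  finally show "(SIGMA y:space borel. {g y<..}) \<in> sets (borel \<Otimes>\<^sub>M borel)" .
qed measurable

text \<open>The defining identity of the kernel determines the joint distribution on rectangles, which
  form an intersection-stable generator of the product \<open>\<sigma>\<close>-algebra.\<close>

lemma disintegration:
  assumes [measurable]: "f \<in> borel_measurable (borel \<Otimes>\<^sub>M borel)"
  shows "(\<integral>\<^sup>+ \<omega>. f (X \<omega>, Y \<omega>) \<partial>M) = (\<integral>\<^sup>+ y. \<integral>\<^sup>+ z. f (z, y) \<partial>K y \<partial>G)"
proof -
  define L where "L = (\<lambda>y. distr (K y) (borel \<Otimes>\<^sub>M borel) (\<lambda>z. (z, y)))"
  have L [measurable]: "L \<in> borel \<rightarrow>\<^sub>M subprob_algebra (borel \<Otimes>\<^sub>M borel)"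
    unfolding L_def by (rule measurable_distr2[where M=borel]) measurable
  have L': "L \<in> G \<rightarrow>\<^sub>M subprob_algebra (borel \<Otimes>\<^sub>M borel)" by simp
  let ?N = "distr M (borel \<Otimes>\<^sub>M borel) (\<lambda>\<omega>. (X \<omega>, Y \<omega>))"
  let ?E = "{A \<times> B | A B. A \<in> sets (borel :: real measure) \<and> B \<in> sets (borel :: real measure)}"
  have "?N = G \<bind> L"
  proof (rule measure_eqI_generator_eq[where E = ?E and \<Omega> = UNIV and A = "\<lambda>_. UNIV"])
    show "Int_stable ?E"
      using Int_stable_pair_measure_generator[of borel borel] by simp
    show "sets ?N = sigma_sets UNIV ?E"
      by (simp add: sets_pair_measure)
    show "sets (G \<bind> L) = sigma_sets UNIV ?E"
      by (subst sets_bind[where N = "borel \<Otimes>\<^sub>M borel"]) (simp_all add: L_def sets_pair_measure)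
    interpret N: prob_space ?N by (rule prob_space_distr) measurable
    show "emeasure ?N UNIV \<noteq> \<infinity>" by simp
    fix C assume "C \<in> ?E"
    then obtain A B where C: "C = A \<times> B" and [measurable]: "A \<in> sets borel" "B \<in> sets borel"
      by blast
    have "emeasure ?N C = emeasure M {\<omega> \<in> space M. X \<omega> \<in> A \<and> Y \<omega> \<in> B}"
      unfolding C by (subst emeasure_distr) (auto intro!: arg_cong[where f="emeasure M"])
    also have "\<dots> = (\<integral>\<^sup>+ y\<in>B. emeasure (K y) A \<partial>G)"
      using cond_distr by (simp add: cond_distr_def)
    also have "\<dots> = (\<integral>\<^sup>+ y. emeasure (L y) C \<partial>G)"
    proof (rule nn_integral_cong)
      fix y
      have "emeasure (L y) C = emeasure (K y) ((\<lambda>z. (z, y)) -` (A \<times> B) \<inter> space (K y))"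
        unfolding L_def C by (rule emeasure_distr) measurable
      also have "(\<lambda>z. (z, y)) -` (A \<times> B) \<inter> space (K y) = (if y \<in> B then A else {})"
        using sets_eq_imp_space_eq[OF sets_kernel, of y] by auto
      finally show "emeasure (K y) A * indicator B y = emeasure (L y) C" by auto
    qed
    also have "\<dots> = emeasure (G \<bind> L) C"
      unfolding C by (rule emeasure_bind[OF _ L', symmetric]) auto
    finally show "emeasure ?N C = emeasure (G \<bind> L) C" .
  qed (auto intro!: exI[of _ UNIV])
  then have "(\<integral>\<^sup>+ p. f p \<partial>?N) = (\<integral>\<^sup>+ p. f p \<partial>(G \<bind> L))" by simp
  also have "\<dots> = (\<integral>\<^sup>+ y. \<integral>\<^sup>+ p. f p \<partial>L y \<partial>G)"
    by (rule nn_integral_bind[OF _ L']) measurable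
  finally show ?thesis
    by (simp add: nn_integral_distr L_def)
qed

lemma emeasure_product_tail:
  assumes [measurable]: "B \<in> sets borel" and B: "B \<subseteq> {0<..}"
  shows "emeasure M {\<omega> \<in> space M. x < X \<omega> * Y \<omega> \<and> Y \<omega> \<in> B}
    = (\<integral>\<^sup>+ y\<in>B. ennreal (measure (K y) {x / y<..}) \<partial>G)"
proof -
  have "emeasure M {\<omega> \<in> space M. x < X \<omega> * Y \<omega> \<and> Y \<omega> \<in> B}
      = (\<integral>\<^sup>+ \<omega>. indicator {p. x < fst p * snd p \<and> snd p \<in> B} (X \<omega>, Y \<omega>) \<partial>M)"
  proof -
    have "{\<omega> \<in> space M. x < X \<omega> * Y \<omega> \<and> Y \<omega> \<in> B} \<in> sets M" by measurable
    from nn_integral_indicator[OF this, symmetric] show ?thesis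
      by (auto intro!: nn_integral_cong simp: indicator_def)
  qed
  also have "\<dots> = (\<integral>\<^sup>+ y. \<integral>\<^sup>+ z. indicator {p. x < fst p * snd p \<and> snd p \<in> B} (z, y) \<partial>K y \<partial>G)"
    by (rule disintegration) measurable
  also have "\<dots> = (\<integral>\<^sup>+ y\<in>B. ennreal (measure (K y) {x / y<..}) \<partial>G)"
  proof (rule nn_integral_cong)
    fix y
    interpret Ky: prob_space "K y" by (rule prob_space_kernel)
    show "(\<integral>\<^sup>+ z. indicator {p. x < fst p * snd p \<and> snd p \<in> B} (z, y) \<partial>K y)
        = ennreal (measure (K y) {x / y<..}) * indicator B y"
    proof (cases "y \<in> B")
      case True
      then have "0 < y" using B by auto
      then have "(\<integral>\<^sup>+ z. indicator {p. x < fst p * snd p \<and> snd p \<in> B} (z, y) \<partial>K y)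
          = (\<integral>\<^sup>+ z. indicator {x / y<..} z \<partial>K y)"
        using True by (intro nn_integral_cong) (auto simp: indicator_def field_simps)
      then show ?thesis using True by (simp add: Ky.emeasure_eq_measure)
    qed simp
  qed
  finally show ?thesis .
qed

end

section \<open>Conditional tails comparable with the tail of the first factor\<close>

text \<open>All constants are absorbed into the bounds \<open>1/3\<close> and \<open>3\<close>, which suffice since both
  classes are described by conditions invariant under bounded factors.\<close>

locale comparable_tails = kernel_product +
  fixes k :: "real \<Rightarrow> real" and \<kappa> v\<^sub>1 :: real
  assumes k [measurable]: "k \<in> borel_measurable borel"
    and k_le: "\<And>y. k y \<le> \<kappa>"
    and v\<^sub>1: "0 < v\<^sub>1"
    and comparable: "AE y in G. 0 \<le> y \<and> 0 < k y \<and> (\<forall>v\<ge>v\<^sub>1.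
      k y / 3 * tail F v \<le> measure (K y) {v<..} \<and> measure (K y) {v<..} \<le> 3 * k y * tail F v)"
    and admissible_F: "admissible F"
    and Y_integrable: "integrable M Y"
    and Y_mean: "0 < expectation Y"
    and G_negligible: "\<And>c. 0 < c \<Longrightarrow> eventually (\<lambda>x. tail G (c * x) \<le> tail H x / 2) at_top"
begin

lemma tail_measure:
  "tail F x = measure F {x<..}" "tail G x = measure G {x<..}" "tail H x = measure H {x<..}"
  by (intro tail_eq_measure prob_spaces; simp)+

lemma tail_F_antimono: "v \<le> w \<Longrightarrow> tail F w \<le> tail F v"
  unfolding tail_measure
  by (intro finite_measure.finite_measure_mono prob_space.finite_measure prob_spaces) auto

lemma tail_F_nonneg: "0 \<le> tail F v"
  by (simp add: tail_measure)

lemma \<kappa>_pos: "0 < \<kappa>"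
proof -
  interpret G: prob_space G by (rule prob_spaces)
  from comparable have "AE y in G. 0 < \<kappa>"
    by (rule eventually_mono) (metis k_le less_le_trans)
  then show ?thesis by simp
qed

lemma X_nonneg: "AE \<omega> in M. 0 \<le> X \<omega>" and Y_nonneg: "AE \<omega> in M. 0 \<le> Y \<omega>"
proof -
  have "AE x in F. 0 \<le> x" using admissible_F by (simp add: admissible_def)
  then show "AE \<omega> in M. 0 \<le> X \<omega>" by (subst (asm) AE_distr_iff) auto
  have "AE y in G. 0 \<le> y" using comparable by (rule eventually_mono) simp
  then show "AE \<omega> in M. 0 \<le> Y \<omega>" by (subst (asm) AE_distr_iff) auto
qed

text \<open>The mean excess is the integral of the tail, so the two-sided bound is inherited by
  integration over \<open>[v, \<infinity>)\<close>.\<close>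

lemma comparable_excess:
  "AE y in G. \<forall>v\<ge>v\<^sub>1. ennreal (k y / 3) * excess F v \<le> excess (K y) v \<and>
     excess (K y) v \<le> ennreal (3 * k y) * excess F v"
  using comparable
proof (rule eventually_mono, intro allI impI)
  fix y v
  assume y: "0 \<le> y \<and> 0 < k y \<and> (\<forall>v\<ge>v\<^sub>1.
    k y / 3 * tail F v \<le> measure (K y) {v<..} \<and> measure (K y) {v<..} \<le> 3 * k y * tail F v)"
    and v: "v\<^sub>1 \<le> v"
  note [measurable] = borel_measurable_tail[OF prob_spaces(1) sets_distr]
  have cmult: "ennreal c * excess F v
      = (\<integral>\<^sup>+ u. ennreal c * (ennreal (measure F {u<..}) * indicator {v..} u) \<partial>lborel)" for c
    unfolding nn_integral_tail[OF prob_spaces(1) sets_distr, symmetric]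
    by (rule nn_integral_cmult[symmetric]) measurable
  show "ennreal (k y / 3) * excess F v \<le> excess (K y) v \<and>
     excess (K y) v \<le> ennreal (3 * k y) * excess F v"
    unfolding cmult nn_integral_tail[OF prob_space_kernel sets_kernel, symmetric]
  proof (intro conjI nn_integral_mono)
    fix u
    show "ennreal (k y / 3) * (ennreal (measure F {u<..}) * indicator {v..} u)
        \<le> ennreal (measure (K y) {u<..}) * indicator {v..} u"
      using y v by (auto simp: indicator_def tail_measure ennreal_mult[symmetric] intro!: ennreal_leI)
    show "ennreal (measure (K y) {u<..}) * indicator {v..} u
        \<le> ennreal (3 * k y) * (ennreal (measure F {u<..}) * indicator {v..} u)"
      using y v by (auto simp: indicator_def tail_measure ennreal_mult[symmetric] intro!: ennreal_leI)
  qed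
qed

lemma excess_H: "excess H x = (\<integral>\<^sup>+ y. \<integral>\<^sup>+ z. ennreal (z * y - x) \<partial>K y \<partial>G)"
proof -
  have "excess H x = (\<integral>\<^sup>+ \<omega>. (\<lambda>p. ennreal (fst p * snd p - x)) (X \<omega>, Y \<omega>) \<partial>M)"
    unfolding excess_def by (subst nn_integral_distr) auto
  also have "\<dots> = (\<integral>\<^sup>+ y. \<integral>\<^sup>+ z. (\<lambda>p. ennreal (fst p * snd p - x)) (z, y) \<partial>K y \<partial>G)"
    by (rule disintegration) measurable
  finally show ?thesis by simp
qed

lemma excess_scaled:
  assumes "0 < y"
  shows "(\<integral>\<^sup>+ z. ennreal (z * y - x) \<partial>K y) = ennreal y * excess (K y) (x / y)"
proof -
  have "(\<integral>\<^sup>+ z. ennreal (z * y - x) \<partial>K y) = (\<integral>\<^sup>+ z. ennreal y * ennreal (z - x / y) \<partial>K y)"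
    using assms by (intro nn_integral_cong) (simp add: ennreal_mult'[symmetric] right_diff_distrib mult.commute)
  also have "\<dots> = ennreal y * excess (K y) (x / y)"
    unfolding excess_def by (rule nn_integral_cmult) measurable
  finally show ?thesis .
qed

definition joint_tail :: "real \<Rightarrow> real set \<Rightarrow> real" where
  "joint_tail x B = prob {\<omega> \<in> space M. x < X \<omega> * Y \<omega> \<and> Y \<omega> \<in> B}"

lemma joint_tail_eq:
  assumes "B \<in> sets borel" "B \<subseteq> {0<..}"
  shows "ennreal (joint_tail x B) = (\<integral>\<^sup>+ y\<in>B. ennreal (measure (K y) {x / y<..}) \<partial>G)"
  unfolding joint_tail_def emeasure_eq_measure[symmetric] by (rule emeasure_product_tail[OF assms])

text \<open>The bound for \<open>F\<close> is applied at \<open>x / y\<close> for each \<open>y \<in> B\<close>. Passing from the conditional tail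
  to the tail of \<open>F\<close>, and from the mean excess of \<open>F\<close> back to the conditional one, costs a
  factor 3 each time, whence the 9.\<close>

lemma excess_H_lower_bound:
  assumes B [measurable]: "B \<in> sets borel" and B_subset: "B \<subseteq> {0<..}"
    and v\<^sub>0: "v\<^sub>1 \<le> v\<^sub>0" "\<And>y. y \<in> B \<Longrightarrow> v\<^sub>0 \<le> x / y"
    and F: "\<And>v. v\<^sub>0 \<le> v \<Longrightarrow> ennreal (r v * tail F v) \<le> excess F v"
    and \<rho>: "0 \<le> \<rho>" "\<And>y. y \<in> B \<Longrightarrow> \<rho> \<le> y * r (x / y)"
  shows "ennreal (\<rho> / 9 * joint_tail x B) \<le> excess H x"
proof -
  have "ennreal (\<rho> / 9 * joint_tail x B) = ennreal (\<rho> / 9) * ennreal (joint_tail x B)"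
    unfolding joint_tail_def using \<rho>(1) by (intro ennreal_mult) auto
  also have "\<dots> = (\<integral>\<^sup>+ y. ennreal (\<rho> / 9) * (ennreal (measure (K y) {x / y<..}) * indicator B y) \<partial>G)"
    unfolding joint_tail_eq[OF B B_subset] by (rule nn_integral_cmult[symmetric]) measurable
  also have "\<dots> \<le> excess H x"
    unfolding excess_H
  proof (rule nn_integral_mono_AE)
    show "AE y in G. ennreal (\<rho> / 9) * (ennreal (measure (K y) {x / y<..}) * indicator B y)
        \<le> (\<integral>\<^sup>+ z. ennreal (z * y - x) \<partial>K y)"
      using comparable comparable_excess
    proof eventually_elim
      case (elim y)
      show ?case
      proof (cases "y \<in> B")
        case True
        define a where "a = x / y"
        have y: "0 < y" and a: "v\<^sub>0 \<le> a" "v\<^sub>1 \<le> a" and r: "\<rho> \<le> y * r a"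
          using True B_subset v\<^sub>0 \<rho>(2) by (auto simp: a_def intro: order_trans)
        have "0 \<le> r a" using r \<rho>(1) y by (metis order_trans zero_le_mult_iff not_less)
        have "\<rho> / 9 * measure (K y) {a<..} \<le> (y * r a) / 9 * (3 * k y * tail F a)"
          using elim(1) a r \<rho>(1) by (intro mult_mono) auto
        also have "\<dots> = y * (k y / 3 * (r a * tail F a))" by simp
        finally have "ennreal (\<rho> / 9) * ennreal (measure (K y) {a<..})
            \<le> ennreal (y * (k y / 3 * (r a * tail F a)))"
          using \<rho>(1) by (simp add: ennreal_mult[symmetric] ennreal_leI)
        also have "\<dots> = ennreal y * (ennreal (k y / 3) * ennreal (r a * tail F a))"
        proof -
          have "0 \<le> y" "0 \<le> k y / 3" "0 \<le> r a * tail F a"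
            using y elim(1) \<open>0 \<le> r a\<close> tail_F_nonneg by auto
          then show ?thesis by (simp only: ennreal_mult mult_nonneg_nonneg)
        qed
        also have "\<dots> \<le> ennreal y * (ennreal (k y / 3) * excess F a)"
          by (intro mult_left_mono F a) auto
        also have "\<dots> \<le> ennreal y * excess (K y) a"
          using elim(2) a by (intro mult_left_mono) auto
        also have "\<dots> = (\<integral>\<^sup>+ z. ennreal (z * y - x) \<partial>K y)"
          unfolding a_def by (rule excess_scaled[OF y, symmetric])
        finally show ?thesis using True by (simp add: a_def)
      qed simp
    qed
  qed
  finally show ?thesis .
qed

lemma tail_H_prob: "tail H x = prob {\<omega> \<in> space M. x < X \<omega> * Y \<omega>}"
  unfolding tail_measure by (subst measure_distr) (auto intro!: arg_cong[where f=prob])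

lemma tail_G_prob: "tail G x = prob {\<omega> \<in> space M. x < Y \<omega>}"
  unfolding tail_measure by (subst measure_distr) (auto intro!: arg_cong[where f=prob])

text \<open>On \<open>XY > x \<ge> 0\<close> the factor \<open>Y\<close> is almost surely positive, and \<open>Y > x / v\<^sub>0\<close> has
  probability at most half of the tail of the product.\<close>

lemma tail_H_truncate:
  assumes "0 < v\<^sub>0"
  shows "eventually (\<lambda>x. tail H x \<le> 2 * joint_tail x {0<..x / v\<^sub>0}) at_top"
proof -
  have "eventually (\<lambda>x. tail G (1 / v\<^sub>0 * x) \<le> tail H x / 2) at_top"
    using assms by (intro G_negligible) simp
  then show ?thesis
    using eventually_ge_at_top[of 0]
  proof eventually_elim
    case (elim x)
    have "tail H x \<le> prob ({\<omega> \<in> space M. x < X \<omega> * Y \<omega> \<and> Y \<omega> \<in> {0<..x / v\<^sub>0}}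
        \<union> {\<omega> \<in> space M. x / v\<^sub>0 < Y \<omega>})"
      unfolding tail_H_prob
    proof (rule finite_measure_mono_AE)
      show "AE \<omega> in M. \<omega> \<in> {\<omega> \<in> space M. x < X \<omega> * Y \<omega>} \<longrightarrow>
          \<omega> \<in> {\<omega> \<in> space M. x < X \<omega> * Y \<omega> \<and> Y \<omega> \<in> {0<..x / v\<^sub>0}}
            \<union> {\<omega> \<in> space M. x / v\<^sub>0 < Y \<omega>}"
        using Y_nonneg
      proof eventually_elim
        case Y: (elim \<omega>)
        have "Y \<omega> \<noteq> 0" if "x < X \<omega> * Y \<omega>" using that elim(2) by auto
        then show ?case using Y by force
      qed
    qed measurable
    also have "\<dots> \<le> joint_tail x {0<..x / v\<^sub>0} + tail G (x / v\<^sub>0)"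
      unfolding joint_tail_def tail_G_prob by (rule measure_Un_le) measurable
    finally show ?case using elim(1) by simp
  qed
qed

text \<open>The intervals \<open>[1/n, n]\<close> exhaust the positive half-line, so if none of them were charged,
  \<open>Y\<close> would vanish almost surely, against \<open>E[Y] > 0\<close>.\<close>

lemma middle_interval_charged:
  obtains \<delta> D where "0 < \<delta>" "\<delta> \<le> D" "0 < (\<integral>\<^sup>+ y\<in>{\<delta>..D}. ennreal (k y) \<partial>G)"
proof -
  have "\<exists>n::nat. 0 < (\<integral>\<^sup>+ y\<in>{1 / Suc n..Suc n}. ennreal (k y) \<partial>G)"
  proof (rule ccontr)
    assume "\<not> ?thesis"
    then have "\<forall>n::nat. (\<integral>\<^sup>+ y\<in>{1 / Suc n..Suc n}. ennreal (k y) \<partial>G) = 0"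
      by (simp add: not_gr_zero)
    then have "\<forall>n::nat. AE y in G. ennreal (k y) * indicator {1 / Suc n..Suc n} y = 0"
      by (subst (asm) nn_integral_0_iff_AE) auto
    then have "AE y in G. \<forall>n::nat. ennreal (k y) * indicator {1 / Suc n..Suc n} y = 0"
      by (rule AE_all_countable[THEN iffD2])
    then have "AE y in G. y = 0"
      using comparable
    proof eventually_elim
      case (elim y)
      show ?case
      proof (rule ccontr)
        assume "y \<noteq> 0"
        then have "0 < y" using elim(2) by simp
        obtain n :: nat where n: "max y (1 / y) \<le> n" using real_arch_simple by blast
        then have "y \<le> Suc n" "1 / y \<le> Suc n" by auto
        then have "y \<in> {1 / Suc n..Suc n}" using \<open>0 < y\<close> by (auto simp: field_simps)
        moreover have "ennreal (k y) * indicator {1 / Suc n..Suc n} y = 0" using elim(1) by blast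
        ultimately have "k y \<le> 0" by (simp add: ennreal_eq_0_iff)
        then show False using elim(2) by simp
      qed
    qed
    then have "AE \<omega> in M. Y \<omega> = 0" by (subst (asm) AE_distr_iff) auto
    then have "expectation Y = 0" by (rule integral_eq_zero_AE)
    then show False using Y_mean by simp
  qed
  then obtain n :: nat where "0 < (\<integral>\<^sup>+ y\<in>{1 / Suc n..Suc n}. ennreal (k y) \<partial>G)" ..
  then show thesis by (intro that[of "1 / Suc n" "Suc n"]) (auto simp: field_simps)
qed

text \<open>Both probabilities are compared with the tail of \<open>F\<close> at \<open>x / \<delta>\<close>: if \<open>y < \<delta>\<close> then
  \<open>x / y > x / \<delta>\<close>, and if \<open>\<delta> \<le> y\<close> then \<open>x / y \<le> x / \<delta>\<close>. The upper bound \<open>D\<close> on the interval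
  where the lower estimate is made keeps \<open>x / y\<close> above \<open>v\<^sub>1\<close>. The constant \<open>c\<close> is chosen before
  \<open>v\<^sub>0\<close>, which lets \<open>v\<^sub>0\<close> depend on the precision wanted later.\<close>

lemma small_factor_dominated:
  obtains \<delta> D c where "0 < \<delta>" "0 \<le> c"
    "\<And>v\<^sub>0 x. v\<^sub>1 \<le> v\<^sub>0 \<Longrightarrow> D * v\<^sub>0 \<le> x \<Longrightarrow>
       0 < joint_tail x {\<delta>..x / v\<^sub>0} \<and> joint_tail x {0<..<\<delta>} \<le> c * joint_tail x {\<delta>..x / v\<^sub>0}"
proof -
  interpret G: prob_space G by (rule prob_spaces)
  obtain \<delta> D where \<delta>: "0 < \<delta>" "\<delta> \<le> D"
    and charged: "0 < (\<integral>\<^sup>+ y\<in>{\<delta>..D}. ennreal (k y) \<partial>G)" (is "0 < ?J")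
    by (rule middle_interval_charged)
  have "?J \<le> (\<integral>\<^sup>+ y. ennreal \<kappa> \<partial>G)"
    using k_le by (intro nn_integral_mono) (auto simp: indicator_def intro: ennreal_leI)
  also have "\<dots> = ennreal \<kappa>" using G.emeasure_space_1 by simp
  finally have "?J < \<infinity>" by (rule le_less_trans) simp
  define b where "b = enn2real ?J"
  have J: "?J = ennreal b" and b: "0 < b"
    using \<open>?J < \<infinity>\<close> charged by (auto simp: b_def enn2real_positive_iff less_top)
  have bounds: "0 < joint_tail x {\<delta>..x / v\<^sub>0} \<and>
      joint_tail x {0<..<\<delta>} \<le> (9 * \<kappa> / b) * joint_tail x {\<delta>..x / v\<^sub>0}"
    if v\<^sub>0: "v\<^sub>1 \<le> v\<^sub>0" and x: "D * v\<^sub>0 \<le> x" for v\<^sub>0 x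
  proof -
    have v\<^sub>0_pos: "0 < v\<^sub>0" using v\<^sub>0 v\<^sub>1 by simp
    have le: "v\<^sub>1 \<le> x / y" if "0 < y" "y \<le> D" for y
    proof -
      have "v\<^sub>1 * y \<le> v\<^sub>0 * D" using that v\<^sub>0 v\<^sub>0_pos by (intro mult_mono) auto
      then show ?thesis using that x by (simp add: field_simps)
    qed
    have x_pos: "0 < x" using x v\<^sub>0_pos \<delta> by (meson less_le_trans mult_pos_pos)
    have "D \<le> x / v\<^sub>0" using x v\<^sub>0_pos by (simp add: field_simps)
    have "ennreal (b * (tail F (x / \<delta>) / 3)) = ?J * ennreal (tail F (x / \<delta>) / 3)"
      unfolding J using b tail_F_nonneg by (intro ennreal_mult) auto
    also have "\<dots> = (\<integral>\<^sup>+ y. (ennreal (k y) * indicator {\<delta>..D} y) * ennreal (tail F (x / \<delta>) / 3) \<partial>G)"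
      by (rule nn_integral_multc[symmetric]) measurable
    also have "\<dots> \<le> (\<integral>\<^sup>+ y\<in>{\<delta>..x / v\<^sub>0}. ennreal (measure (K y) {x / y<..}) \<partial>G)"
    proof (rule nn_integral_mono_AE)
      show "AE y in G. (ennreal (k y) * indicator {\<delta>..D} y) * ennreal (tail F (x / \<delta>) / 3)
          \<le> ennreal (measure (K y) {x / y<..}) * indicator {\<delta>..x / v\<^sub>0} y"
        using comparable
      proof eventually_elim
        case (elim y)
        show ?case
        proof (cases "y \<in> {\<delta>..D}")
          case True
          then have "x / y \<le> x / \<delta>" using \<delta> x_pos by (intro divide_left_mono) auto
          then have "k y / 3 * tail F (x / \<delta>) \<le> k y / 3 * tail F (x / y)"
            using elim by (intro mult_left_mono tail_F_antimono) auto
          also have "\<dots> \<le> measure (K y) {x / y<..}"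
            using elim le[of y] True \<delta> by auto
          finally show ?thesis
            using True \<open>D \<le> x / v\<^sub>0\<close> elim tail_F_nonneg
            by (auto simp: ennreal_mult[symmetric] intro!: ennreal_leI)
        qed simp
      qed
    qed
    also have "\<dots> = ennreal (joint_tail x {\<delta>..x / v\<^sub>0})"
      using \<delta> by (intro joint_tail_eq[symmetric]) auto
    finally have lower: "b * (tail F (x / \<delta>) / 3) \<le> joint_tail x {\<delta>..x / v\<^sub>0}"
      by (simp add: ennreal_le_iff joint_tail_def)
    have "ennreal (joint_tail x {0<..<\<delta>})
        = (\<integral>\<^sup>+ y\<in>{0<..<\<delta>}. ennreal (measure (K y) {x / y<..}) \<partial>G)"
      by (intro joint_tail_eq) auto
    also have "\<dots> \<le> (\<integral>\<^sup>+ y. ennreal (3 * \<kappa> * tail F (x / \<delta>)) \<partial>G)"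
    proof (rule nn_integral_mono_AE)
      show "AE y in G. ennreal (measure (K y) {x / y<..}) * indicator {0<..<\<delta>} y
          \<le> ennreal (3 * \<kappa> * tail F (x / \<delta>))"
        using comparable
      proof eventually_elim
        case (elim y)
        show ?case
        proof (cases "y \<in> {0<..<\<delta>}")
          case True
          then have "x / \<delta> \<le> x / y" using x_pos by (intro divide_left_mono) auto
          have "measure (K y) {x / y<..} \<le> 3 * k y * tail F (x / y)"
            using elim le[of y] True \<delta> by auto
          also have "\<dots> \<le> 3 * \<kappa> * tail F (x / \<delta>)"
            using elim k_le[of y] \<kappa>_pos tail_F_nonneg \<open>x / \<delta> \<le> x / y\<close>
            by (intro mult_mono tail_F_antimono) auto
          finally show ?thesis using True by (simp add: ennreal_leI)
        qed simp
      qed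
    qed
    also have "\<dots> = ennreal (3 * \<kappa> * tail F (x / \<delta>))" using G.emeasure_space_1 by simp
    finally have upper: "joint_tail x {0<..<\<delta>} \<le> 3 * \<kappa> * tail F (x / \<delta>)"
      using \<kappa>_pos tail_F_nonneg by (simp add: ennreal_le_iff)
    have "3 * \<kappa> * tail F (x / \<delta>) = (9 * \<kappa> / b) * (b * (tail F (x / \<delta>) / 3))"
      using b by simp
    also have "\<dots> \<le> (9 * \<kappa> / b) * joint_tail x {\<delta>..x / v\<^sub>0}"
      using lower b \<kappa>_pos by (intro mult_left_mono) auto
    finally have "joint_tail x {0<..<\<delta>} \<le> (9 * \<kappa> / b) * joint_tail x {\<delta>..x / v\<^sub>0}"
      using upper by simp
    moreover have "0 < tail F (x / \<delta>)"
      using admissible_F x_pos \<delta> by (simp add: admissible_def)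
    then have "0 < joint_tail x {\<delta>..x / v\<^sub>0}"
      using lower b by (intro less_le_trans[OF _ lower]) simp
    ultimately show ?thesis by blast
  qed
  show thesis
    using b \<kappa>_pos by (intro that[of \<delta> "9 * \<kappa> / b" D] \<delta> bounds) auto
qed

lemma tail_H_pos: "0 < tail H x"
proof -
  obtain \<delta> D and c :: real where *: "\<And>v\<^sub>0 x. v\<^sub>1 \<le> v\<^sub>0 \<Longrightarrow> D * v\<^sub>0 \<le> x \<Longrightarrow> 0 < joint_tail x {\<delta>..x / v\<^sub>0}"
    using small_factor_dominated by metis
  define u where "u = max x (D * v\<^sub>1)"
  have "0 < joint_tail u {\<delta>..u / v\<^sub>1}" by (rule *) (auto simp: u_def)
  also have "\<dots> \<le> tail H x"
    unfolding joint_tail_def tail_H_prob by (rule finite_measure_mono) (auto simp: u_def)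
  finally show ?thesis .
qed

text \<open>Given \<open>Y = y\<close>, the mean of \<open>X\<close> is at most \<open>v\<^sub>1\<close> plus the excess over \<open>v\<^sub>1\<close>, and this excess is
  bounded uniformly in \<open>y\<close> because \<open>k \<le> \<kappa>\<close>. So the mean of the product is at most a constant
  times the mean of \<open>Y\<close>.\<close>

lemma product_integrable: "integrable M (\<lambda>\<omega>. X \<omega> * Y \<omega>)"
proof (rule integrableI_nonneg)
  show "AE \<omega> in M. 0 \<le> X \<omega> * Y \<omega>"
    using X_nonneg Y_nonneg by eventually_elim simp
  define C where "C = ennreal v\<^sub>1 + ennreal (3 * \<kappa>) * excess F v\<^sub>1"
  have "C < \<infinity>"
    unfolding C_def using mean_tail_I[OF admissible_F, of v\<^sub>1, symmetric]
    by (simp add: ennreal_mult_less_top)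
  have "(\<integral>\<^sup>+ \<omega>. ennreal (X \<omega> * Y \<omega>) \<partial>M) = excess H 0"
    unfolding excess_def by (subst nn_integral_distr) auto
  also have "\<dots> \<le> (\<integral>\<^sup>+ y. ennreal y * C \<partial>G)"
    unfolding excess_H
  proof (rule nn_integral_mono_AE)
    show "AE y in G. (\<integral>\<^sup>+ z. ennreal (z * y - 0) \<partial>K y) \<le> ennreal y * C"
      using comparable comparable_excess
    proof eventually_elim
      case (elim y)
      show ?case
      proof (cases "y = 0")
        case False
        interpret Ky: prob_space "K y" by (rule prob_space_kernel)
        have "excess (K y) 0 \<le> (\<integral>\<^sup>+ z. ennreal v\<^sub>1 + ennreal (z - v\<^sub>1) \<partial>K y)"
          unfolding excess_def
        proof (rule nn_integral_mono)
          fix z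
          show "ennreal (z - 0) \<le> ennreal v\<^sub>1 + ennreal (z - v\<^sub>1)"
            using v\<^sub>1 by (cases "v\<^sub>1 \<le> z") (auto simp: ennreal_plus[symmetric] ennreal_neg ennreal_leI
                simp del: ennreal_plus)
        qed
        also have "\<dots> = ennreal v\<^sub>1 + excess (K y) v\<^sub>1"
          unfolding excess_def by (subst nn_integral_add) (auto simp: Ky.emeasure_space_1)
        also have "excess (K y) v\<^sub>1 \<le> ennreal (3 * k y) * excess F v\<^sub>1"
          using elim(2) by blast
        also have "\<dots> \<le> ennreal (3 * \<kappa>) * excess F v\<^sub>1"
          using k_le[of y] by (intro mult_right_mono ennreal_leI) auto
        finally have "excess (K y) 0 \<le> C" by (simp add: C_def)
        then show ?thesis
          using excess_scaled[of y 0] elim(1) False by (simp add: mult_left_mono)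
      qed simp
    qed
  qed
  also have "\<dots> = (\<integral>\<^sup>+ \<omega>. ennreal (Y \<omega>) \<partial>M) * C"
    by (subst nn_integral_multc) (auto simp: nn_integral_distr)
  also have "\<dots> < \<infinity>"
    using \<open>C < \<infinity>\<close> nn_integral_eq_integral[OF Y_integrable Y_nonneg]
    by (simp add: ennreal_mult_less_top)
  finally show "(\<integral>\<^sup>+ \<omega>. ennreal (X \<omega> * Y \<omega>) \<partial>M) < \<infinity>" .
qed measurable

lemma admissible_H: "admissible H"
proof -
  have rd: "real_distribution H"
    by (rule real_distribution_distr) measurable
  have nonneg: "AE \<omega> in M. 0 \<le> X \<omega> * Y \<omega>"
    using X_nonneg Y_nonneg by eventually_elim simp
  have mean: "mean H = expectation (\<lambda>\<omega>. X \<omega> * Y \<omega>)"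
    unfolding mean_def by (rule integral_distr) measurable
  have "mean H \<noteq> 0"
  proof
    assume "mean H = 0"
    then have "AE \<omega> in M. X \<omega> * Y \<omega> = 0"
      unfolding mean using integral_nonneg_eq_0_iff_AE[OF product_integrable nonneg] by simp
    then have "AE \<omega> in M. \<omega> \<notin> {\<omega> \<in> space M. 0 < X \<omega> * Y \<omega>}"
      by eventually_elim auto
    then have "tail H 0 = 0"
      unfolding tail_H_prob by (subst prob_eq_0) auto
    then show False using tail_H_pos[of 0] by simp
  qed
  moreover have "0 \<le> mean H" unfolding mean by (rule integral_nonneg_AE[OF nonneg])
  ultimately show ?thesis
    unfolding admissible_def using rd nonneg tail_H_pos product_integrable
    by (auto simp: AE_distr_iff integrable_distr_eq)
qed

section \<open>Closure of the two classes under products\<close>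

text \<open>Here \<open>r(v) = v / C\<close>, for which \<open>y r(x / y) = x / C\<close> for every \<open>y\<close>: small values of \<open>Y\<close>
  need no separate treatment.\<close>

lemma class_M_star_product:
  assumes "F \<in> class_M_star"
  shows "H \<in> class_M_star"
proof -
  have "Limsup at_top (\<lambda>v. ereal (v * tail F v / (mean F * tail_I F v))) < \<infinity>"
    using assms by (simp add: class_M_star_def)
  then obtain c where "Limsup at_top (\<lambda>v. ereal (v * tail F v / (mean F * tail_I F v))) < ereal c"
    using less_PInf_Ex_of_nat by (metis ereal_dense2)
  then have "eventually (\<lambda>v. ereal (v * tail F v / (mean F * tail_I F v)) < ereal c) at_top"
    by (rule Limsup_lessD)
  then obtain V where V: "\<And>v. V \<le> v \<Longrightarrow> v * tail F v / (mean F * tail_I F v) < c"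
    by (auto simp: eventually_at_top_linorder)
  \<comment> \<open>The limsup bound \<open>c\<close> need not be positive, but \<open>C\<close> is used as a divisor.\<close>
  define C where "C = max c 1"
  define v\<^sub>0 where "v\<^sub>0 = max V v\<^sub>1"
  have C: "0 < C" and v\<^sub>0: "v\<^sub>1 \<le> v\<^sub>0" "0 < v\<^sub>0" using v\<^sub>1 by (auto simp: C_def v\<^sub>0_def)
  have F: "ennreal (v / C * tail F v) \<le> excess F v" if "v\<^sub>0 \<le> v" for v
  proof -
    have "v * tail F v / (mean F * tail_I F v) \<le> C" using V[of v] that by (simp add: C_def v\<^sub>0_def)
    then have "v / C * tail F v \<le> mean F * tail_I F v"
      using mean_tail_I_pos[OF admissible_F, of v] that v\<^sub>0 C by (simp add: field_simps)
    then show ?thesis by (simp add: mean_tail_I[OF admissible_F, symmetric] ennreal_leI)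
  qed
  have "eventually (\<lambda>x. ereal (x * tail H x / (mean H * tail_I H x)) \<le> ereal (18 * C)) at_top"
    using tail_H_truncate[OF v\<^sub>0(2)] eventually_gt_at_top[of 0]
  proof eventually_elim
    case (elim x)
    have pos: "0 < mean H * tail_I H x"
      using elim by (intro mean_tail_I_pos admissible_H) simp
    have "ennreal (x / C / 9 * joint_tail x {0<..x / v\<^sub>0}) \<le> excess H x"
    proof (rule excess_H_lower_bound[where v\<^sub>0 = v\<^sub>0 and r = "\<lambda>v. v / C"])
      show "v\<^sub>0 \<le> x / y" if "y \<in> {0<..x / v\<^sub>0}" for y
        using that v\<^sub>0 by (simp add: field_simps)
    qed (use elim C v\<^sub>0 F in auto)
    then have "x / C / 9 * joint_tail x {0<..x / v\<^sub>0} \<le> mean H * tail_I H x"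
      using pos by (simp add: mean_tail_I[OF admissible_H, symmetric] ennreal_le_iff)
    moreover have "x / C / 9 * (tail H x / 2) \<le> x / C / 9 * joint_tail x {0<..x / v\<^sub>0}"
      using elim C by (intro mult_left_mono) auto
    ultimately have "x / C / 9 * (tail H x / 2) \<le> mean H * tail_I H x" by (rule order_trans[rotated])
    then show ?case using pos C by (simp add: field_simps)
  qed
  then have "Limsup at_top (\<lambda>x. ereal (x * tail H x / (mean H * tail_I H x))) \<le> ereal (18 * C)"
    by (rule Limsup_bounded)
  then show ?thesis
    using admissible_H by (auto simp: class_M_star_def)
qed

text \<open>Here \<open>r\<close> is the constant \<open>1 / \<eta>\<close>, and small values of \<open>Y\<close> are removed first at the price of
  the factor \<open>1 + c\<close>.\<close>

lemma class_M_product: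
  assumes "F \<in> class_M"
  shows "H \<in> class_M"
proof -
  obtain \<delta> D c where \<delta>: "0 < \<delta>" and c: "0 \<le> c"
    and dominated: "\<And>v\<^sub>0 x. v\<^sub>1 \<le> v\<^sub>0 \<Longrightarrow> D * v\<^sub>0 \<le> x \<Longrightarrow>
       joint_tail x {0<..<\<delta>} \<le> c * joint_tail x {\<delta>..x / v\<^sub>0}"
    using small_factor_dominated by metis
  have "((\<lambda>x. tail H x / (mean H * tail_I H x)) \<longlongrightarrow> 0) at_top"
  proof (rule tendstoI)
    fix e :: real assume "0 < e"
    \<comment> \<open>The losses are 2 (truncation), \<open>1 + c\<close> (small factors) and 9 (comparison); another
      factor 2 makes the final inequality strict.\<close>
    define \<eta> where "\<eta> = e * \<delta> / (36 * (1 + c))"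
    have \<eta>: "0 < \<eta>" using \<open>0 < e\<close> \<delta> c by (simp add: \<eta>_def)
    have "((\<lambda>v. tail F v / (mean F * tail_I F v)) \<longlongrightarrow> 0) at_top"
      using assms by (simp add: class_M_def)
    from order_tendstoD(2)[OF this \<eta>]
    obtain V where V: "\<And>v. V \<le> v \<Longrightarrow> tail F v / (mean F * tail_I F v) < \<eta>"
      by (auto simp: eventually_at_top_linorder)
    define v\<^sub>0 where "v\<^sub>0 = max V v\<^sub>1"
    have v\<^sub>0: "v\<^sub>1 \<le> v\<^sub>0" "0 < v\<^sub>0" using v\<^sub>1 by (auto simp: v\<^sub>0_def)
    have F: "ennreal (1 / \<eta> * tail F v) \<le> excess F v" if "v\<^sub>0 \<le> v" for v
    proof -
      have "tail F v / (mean F * tail_I F v) \<le> \<eta>" using V[of v] that by (simp add: v\<^sub>0_def)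
      then have "1 / \<eta> * tail F v \<le> mean F * tail_I F v"
        using mean_tail_I_pos[OF admissible_F, of v] that v\<^sub>0 \<eta> by (simp add: field_simps)
      then show ?thesis by (simp add: mean_tail_I[OF admissible_F, symmetric] ennreal_leI)
    qed
    show "eventually (\<lambda>x. dist (tail H x / (mean H * tail_I H x)) 0 < e) at_top"
      using tail_H_truncate[OF v\<^sub>0(2)] eventually_ge_at_top[of 0] eventually_ge_at_top[of "D * v\<^sub>0"]
    proof eventually_elim
      case (elim x)
      let ?T = "joint_tail x {\<delta>..x / v\<^sub>0}"
      have pos: "0 < mean H * tail_I H x"
        using elim by (intro mean_tail_I_pos admissible_H)
      have "ennreal (\<delta> / \<eta> / 9 * ?T) \<le> excess H x"
      proof (rule excess_H_lower_bound[where v\<^sub>0 = v\<^sub>0 and r = "\<lambda>v. 1 / \<eta>"])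
        show "v\<^sub>0 \<le> x / y" if "y \<in> {\<delta>..x / v\<^sub>0}" for y
          using that v\<^sub>0 \<delta> by (simp add: field_simps)
        show "\<delta> / \<eta> \<le> y * (1 / \<eta>)" if "y \<in> {\<delta>..x / v\<^sub>0}" for y
          using that \<eta> by (simp add: divide_right_mono)
      qed (use \<delta> \<eta> v\<^sub>0 F in auto)
      then have excess: "\<delta> / \<eta> / 9 * ?T \<le> mean H * tail_I H x"
        using pos by (simp add: mean_tail_I[OF admissible_H, symmetric] ennreal_le_iff)
      have "joint_tail x {0<..x / v\<^sub>0}
          \<le> prob ({\<omega> \<in> space M. x < X \<omega> * Y \<omega> \<and> Y \<omega> \<in> {0<..<\<delta>}}
             \<union> {\<omega> \<in> space M. x < X \<omega> * Y \<omega> \<and> Y \<omega> \<in> {\<delta>..x / v\<^sub>0}})"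
        unfolding joint_tail_def by (rule finite_measure_mono) auto
      also have "\<dots> \<le> joint_tail x {0<..<\<delta>} + ?T"
        unfolding joint_tail_def by (rule measure_Un_le) measurable
      also have "\<dots> \<le> (1 + c) * ?T"
        using dominated[OF v\<^sub>0(1) elim(3)] by (simp add: algebra_simps)
      finally have "tail H x \<le> 2 * ((1 + c) * ?T)" using elim(1) by simp
      also have "\<dots> = (18 * (1 + c) * \<eta> / \<delta>) * (\<delta> / \<eta> / 9 * ?T)"
        using \<delta> \<eta> by simp
      also have "\<dots> \<le> (18 * (1 + c) * \<eta> / \<delta>) * (mean H * tail_I H x)"
        using \<delta> \<eta> c by (intro mult_left_mono excess) auto
      also have "18 * (1 + c) * \<eta> / \<delta> = e / 2"
        using \<delta> c by (simp add: \<eta>_def divide_simps)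
      finally have "tail H x / (mean H * tail_I H x) \<le> e / 2"
        using pos by (simp add: divide_le_eq)
      moreover have "0 \<le> tail H x / (mean H * tail_I H x)"
        using pos tail_H_pos[of x] by (intro divide_nonneg_pos) auto
      ultimately have "\<bar>tail H x / (mean H * tail_I H x)\<bar> < e" using \<open>0 < e\<close> by linarith
      then show ?case by (simp only: dist_real_def diff_zero)
    qed
  qed
  then show ?thesis using admissible_H by (simp add: class_M_def)
qed

end

section \<open>From uniform equivalence to comparable tails\<close>

text \<open>Once the relative error is below \<open>1/2\<close>, the ratio \<open>K\<^sub>y(v) / P[X > v]\<close> of the tails lies between
  \<open>h(y) / 2\<close> and \<open>3 h(y) / 2\<close> for every \<open>v \<ge> v\<^sub>1\<close>, so its values at two levels differ by a factor of at
  most 3. Its value at \<open>v\<^sub>1\<close> can therefore replace \<open>h\<close>, which may fail to be measurable or bounded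
  off the support.\<close>

lemma comparable_tails_of_uniform_equivalence:
  assumes "kernel_product M X Y K"
    and h: "\<And>y. 0 \<le> y \<Longrightarrow> 0 < h y"
    and Y_nonneg: "AE \<omega> in M. 0 \<le> Y \<omega>" and "integrable M Y" "0 < integral\<^sup>L M Y"
    and F: "admissible (distr M borel X)"
    and A: "\<And>c. c > 0 \<Longrightarrow> (\<lambda>x. tail (distr M borel Y) (c * x))
      \<in> o[at_top](\<lambda>x. tail (distr M borel (\<lambda>\<omega>. X \<omega> * Y \<omega>)) x)"
    and B: "((\<lambda>x. SUP y\<in>msupport (distr M borel Y).
       ereal \<bar>measure (K y) {x<..} / (h y * tail (distr M borel X) x) - 1\<bar>) \<longlongrightarrow> 0) at_top"
  obtains k \<kappa> v\<^sub>1 where "comparable_tails M X Y K k \<kappa> v\<^sub>1"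
proof -
  interpret kernel_product M X Y K by fact
  have "eventually (\<lambda>x. (SUP y\<in>msupport G. ereal \<bar>measure (K y) {x<..} / (h y * tail F x) - 1\<bar>)
      < ereal (1 / 2)) at_top"
    using B by (rule order_tendstoD(2)) simp
  then obtain V where V: "\<And>x. V \<le> x \<Longrightarrow>
      (SUP y\<in>msupport G. ereal \<bar>measure (K y) {x<..} / (h y * tail F x) - 1\<bar>) < ereal (1 / 2)"
    by (auto simp: eventually_at_top_linorder)
  define v\<^sub>1 where "v\<^sub>1 = max V 1"
  define k where "k y = measure (K y) {v\<^sub>1<..} / tail F v\<^sub>1" for y
  have v\<^sub>1: "0 < v\<^sub>1" by (simp add: v\<^sub>1_def)
  have F_pos: "0 < tail F v" if "0 \<le> v" for v using F that by (simp add: admissible_def)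
  have near: "h y / 2 * tail F v \<le> measure (K y) {v<..} \<and> measure (K y) {v<..} \<le> 3 / 2 * h y * tail F v"
    if "y \<in> msupport G" "0 \<le> y" "v\<^sub>1 \<le> v" for y v
  proof -
    have "ereal \<bar>measure (K y) {v<..} / (h y * tail F v) - 1\<bar>
        \<le> (SUP y\<in>msupport G. ereal \<bar>measure (K y) {v<..} / (h y * tail F v) - 1\<bar>)"
      using that(1) by (rule SUP_upper)
    also have "\<dots> < ereal (1 / 2)" using that(3) by (intro V) (simp add: v\<^sub>1_def)
    finally have "\<bar>measure (K y) {v<..} / (h y * tail F v) - 1\<bar> < 1 / 2" by simp
    then have q: "1 / 2 \<le> measure (K y) {v<..} / (h y * tail F v)"
      "measure (K y) {v<..} / (h y * tail F v) \<le> 3 / 2" by linarith+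
    have "0 < h y * tail F v" using h[OF that(2)] F_pos[of v] that(3) v\<^sub>1 by simp
    then show ?thesis using q by (simp add: pos_le_divide_eq pos_divide_le_eq)
  qed
  have "comparable_tails M X Y K k (1 / tail F v\<^sub>1) v\<^sub>1"
  proof unfold_locales
    show "k \<in> borel_measurable borel" unfolding k_def by measurable
    show "0 < v\<^sub>1" by fact
    show "k y \<le> 1 / tail F v\<^sub>1" for y
      unfolding k_def using F_pos[of v\<^sub>1] v\<^sub>1 prob_space.prob_le_1[OF prob_space_kernel]
      by (intro divide_right_mono) auto
    have "AE y in G. y \<in> msupport G" by (rule AE_msupport) simp
    moreover have "AE y in G. 0 \<le> y" using Y_nonneg by (simp add: AE_distr_iff)
    ultimately show "AE y in G. 0 \<le> y \<and> 0 < k y \<and> (\<forall>v\<ge>v\<^sub>1.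
      k y / 3 * tail F v \<le> measure (K y) {v<..} \<and> measure (K y) {v<..} \<le> 3 * k y * tail F v)"
    proof eventually_elim
      case (elim y)
      have k: "h y / 2 \<le> k y" "k y \<le> 3 / 2 * h y"
        using near[OF elim order_refl] F_pos[of v\<^sub>1] v\<^sub>1
        by (simp_all add: k_def pos_le_divide_eq pos_divide_le_eq)
      have "k y / 3 * tail F v \<le> measure (K y) {v<..} \<and> measure (K y) {v<..} \<le> 3 * k y * tail F v"
        if "v\<^sub>1 \<le> v" for v
      proof
        have F0: "0 \<le> tail F v" using F_pos[of v] that v\<^sub>1 by simp
        have "k y / 3 * tail F v \<le> h y / 2 * tail F v" using k F0 by (intro mult_right_mono) auto
        then show "k y / 3 * tail F v \<le> measure (K y) {v<..}" using near[OF elim that] by simp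
        have "3 / 2 * h y * tail F v \<le> 3 * k y * tail F v" using k F0 by (intro mult_right_mono) auto
        then show "measure (K y) {v<..} \<le> 3 * k y * tail F v" using near[OF elim that] by simp
      qed
      then show ?case using elim k h[of y] by simp
    qed
    show "admissible F" "integrable M Y" "0 < expectation Y" by fact+
    show "eventually (\<lambda>x. tail G (c * x) \<le> tail H x / 2) at_top" if "0 < c" for c
    proof -
      have "0 \<le> tail H x" for x
        using tail_eq_measure[OF prob_spaces(3)] by simp
      with landau_o.smallD[OF A[OF that], of "1 / 2"] show ?thesis
        by (auto elim!: eventually_mono)
    qed
  qed
  then show thesis by (rule that)
qed

theorem theorem2p1:
  fixes M :: "'a measure" and X Y :: "'a \<Rightarrow> real" and F G H :: "real measure"
    and K :: "real \<Rightarrow> real measure"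
  assumes "prob_space M"
    and "X \<in> borel_measurable M" and "Y \<in> borel_measurable M"
    and "AE \<omega> in M. 0 \<le> X \<omega>" and "AE \<omega> in M. 0 \<le> Y \<omega>"
    and "F = distr M borel X" and "G = distr M borel Y"
    and "H = distr M borel (\<lambda>\<omega>. X \<omega> * Y \<omega>)"
    and "msupport F = {0..}"
    and "cond_distr M X Y K"
    and A: "\<And>c. c > 0 \<Longrightarrow> (\<lambda>x. tail G (c * x)) \<in> o[at_top](\<lambda>x. tail H x)"
    and B: "\<exists>h :: real \<Rightarrow> real. (\<forall>y\<ge>0. 0 < h y) \<and>
      ((\<lambda>x. SUP y\<in>msupport G. ereal \<bar>measure (K y) {x<..} / (h y * tail F x) - 1\<bar>)
         \<longlongrightarrow> 0) at_top"
    and "integrable M Y" and "0 < integral\<^sup>L M Y"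
  shows "(F \<in> class_M_star \<longrightarrow> H \<in> class_M_star) \<and> (F \<in> class_M \<longrightarrow> H \<in> class_M)"
proof -
  have kp: "kernel_product M X Y K"
    using assms by (simp add: kernel_product_def kernel_product_axioms_def)
  obtain h :: "real \<Rightarrow> real" where h: "\<And>y. 0 \<le> y \<Longrightarrow> 0 < h y"
    and lim: "((\<lambda>x. SUP y\<in>msupport G. ereal \<bar>measure (K y) {x<..} / (h y * tail F x) - 1\<bar>)
      \<longlongrightarrow> 0) at_top"
    using B by blast
  have ?thesis if adm: "admissible F"
  proof -
    obtain k \<kappa> v\<^sub>1 where "comparable_tails M X Y K k \<kappa> v\<^sub>1"
      by (rule comparable_tails_of_uniform_equivalence[where h = h, OF kp])
        (use h lim A adm assms in auto)
    then interpret comparable_tails M X Y K k \<kappa> v\<^sub>1 .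
    show ?thesis
      using class_M_product class_M_star_product by (simp add: assms)
  qed
  then show ?thesis by (auto simp: class_M_def class_M_star_def)
qed

end
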